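(* Let $\theta\neq0$ and $\mathbb{M}\in\mathbb{D}_{++}^{n}$. Equip $\mathcal{L}_{++}^{n}$ either with the metric $\theta$-DPM or with the metric $(\theta,\mathbb{M})$-DBWM (defined in the context), and let $\oplus$ and $\odot$ be the associated gyro operations with the identity matrix $I$ as origin. Set $\beta=\theta$ for $\theta$-DPM and $\beta=\theta/2$ for $(\theta,\mathbb{M})$-DBWM. Then for $L,K\in\mathcal{L}_{++}^{n}$ and $t\in\mathbb{R}$, $$L\oplus K=\lfloor L\rfloor+\lfloor K\rfloor+\left(\mathbb{L}^\beta+\mathbb{K}^\beta-I\right)^{1/\beta},$$ $$t\odot L=t\lfloor L\rfloor+\left(t\mathbb{L}^\beta+(1-t)I\right)^{1/\beta},$$ where $L\oplus K$ requires (for being well defined) that $\mathbb{L}^\beta+\mathbb{K}^\beta-I\in\mathbb{D}_{++}^{n}$, and $t\odot L$ requires that $(1-t)I+t\mathbb{L}^\beta\in\mathbb{D}_{++}^{n}$.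
   Context: $\mathcal{L}_{++}^{n}$ is the manifold of real $n\times n$ lower triangular matrices with positive diagonal entries (open in the space of lower triangular matrices, which is identified with each tangent space); $\mathbb{D}_{++}^{n}$ is the set of $n\times n$ diagonal matrices with positive diagonal entries. For a square matrix $A$, $\lfloor A\rfloor$ is its strictly lower triangular part and the blackboard-bold letter $\mathbb{A}$ is the diagonal matrix with the diagonal entries of $A$. Powers of positive diagonal matrices are entrywise on the diagonal; $\langle\cdot,\cdot\rangle$ is the Frobenius inner product. The Riemannian metrics on $\mathcal{L}_{++}^{n}$ are: - $\theta$-DPM: $g_L(X,Y)=\langle\lfloor X\rfloor,\lfloor Y\rfloor\rangle+\langle\mathbb{L}^{\theta-1}\mathbb{X},\mathbb{L}^{\theta-1}\mathbb{Y}\rangle$; - $(\theta,\mathbb{M})$-DBWM: $g_L(X,Y)=\langle\lfloor X\rfloor,\lfloor Y\rfloor\rangle+\frac14\langle\mathbb{L}^{\theta-2}\mathbb{X},\mathbb{M}^{-1}\mathbb{Y}\rangle$. For such a metric, with $\operatorname{Exp}$, $\operatorname{Log}$ the Riemannian exponential and logarithm and $\operatorname{PT}_{P\to Q}$ the parallel transport along the geodesic connecting $P$ and $Q$, the gyro operations with origin $I$ are $$L\oplus K=\operatorname{Exp}_L\left(\operatorname{PT}_{I\to L}(\operatorname{Log}_I(K))\right),\qquad t\odot L=\operatorname{Exp}_I\left(t\operatorname{Log}_I(L)\right),$$ whenever the exponentials (which are only locally defined, i.e. $\operatorname{Exp}_L(X)$ is the value at time $1$ of the geodesic from $L$ with initial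 velocity $X$ when that geodesic exists up to time $1$) are defined. *)

theory Defs
  imports "HOL-Analysis.Analysis"
begin

section \<open>Riemannian geometry on an open subset of a vector space\<close>

text \<open>
  Throughout, \<open>V\<close> is a linear subspace of a Euclidean space, \<open>U\<close> is a subset of \<open>V\<close> that is open
  in \<open>V\<close>, every tangent space of \<open>U\<close> is identified with \<open>V\<close>, and \<open>g p X Y\<close> is a Riemannian metric
  on \<open>U\<close>. The inner product of the ambient Euclidean space plays no role in this section.
  Partially defined operations return an \<^typ>\<open>'a option\<close>; \<^const>\<open>None\<close> means undefined.
\<close>

definition the_unique :: "('b \<Rightarrow> bool) \<Rightarrow> 'b option" where
  "the_unique P = (if \<exists>!x. P x then Some (THE x. P x) else None)"

text \<open>
  In the global linear chart a connection is \<open>\<nabla>\<^bsub>X\<^esub> Y = D Y(X) + \<Gamma>(X, Y)\<close> with \<open>\<Gamma>\<close> bilinear. Evaluated on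
  constant vector fields, the two conditions below say that \<open>\<nabla>\<close> is torsion-free (\<open>\<Gamma>\<close> is symmetric) and
  compatible with \<open>g\<close>, that is, \<open>Z (g(X, Y)) = g(\<nabla>\<^bsub>Z\<^esub> X, Y) + g(X, \<nabla>\<^bsub>Z\<^esub> Y)\<close>. Linearity in the first
  argument follows from symmetry.
\<close>

definition is_levi_civita ::
  "'a::euclidean_space set \<Rightarrow> 'a set \<Rightarrow> ('a \<Rightarrow> 'a \<Rightarrow> 'a \<Rightarrow> real) \<Rightarrow> ('a \<Rightarrow> 'a \<Rightarrow> 'a \<Rightarrow> 'a) \<Rightarrow> bool" where
  "is_levi_civita V U g \<Gamma> \<longleftrightarrow>
    (\<forall>p\<in>U. \<forall>X\<in>V. \<forall>Y\<in>V. \<forall>Z\<in>V.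
        \<Gamma> p X Y \<in> V
      \<and> (\<forall>a b. \<Gamma> p X (a *\<^sub>R Y + b *\<^sub>R Z) = a *\<^sub>R \<Gamma> p X Y + b *\<^sub>R \<Gamma> p X Z)
      \<and> \<Gamma> p X Y = \<Gamma> p Y X
      \<and> ((\<lambda>s. g (p + s *\<^sub>R Z) X Y) has_real_derivative
            (g p (\<Gamma> p Z X) Y + g p X (\<Gamma> p Z Y))) (at 0))"

text \<open>
  By the fundamental theorem of Riemannian geometry \<open>\<Gamma>\<close> exists and is unique on \<open>U \<times> V \<times> V\<close>; its
  values elsewhere are arbitrary and are never used.
\<close>

definition christoffel ::
  "'a::euclidean_space set \<Rightarrow> 'a set \<Rightarrow> ('a \<Rightarrow> 'a \<Rightarrow> 'a \<Rightarrow> real) \<Rightarrow> 'a \<Rightarrow> 'a \<Rightarrow> 'a \<Rightarrow> 'a" where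
  "christoffel V U g = (SOME \<Gamma>. is_levi_civita V U g \<Gamma>)"

text \<open>Curves are parametrised by \<open>[0, 1]\<close>, with one-sided derivatives at the end points.\<close>

definition curve_velocity :: "'a::euclidean_space set \<Rightarrow> (real \<Rightarrow> 'a) \<Rightarrow> (real \<Rightarrow> 'a) \<Rightarrow> bool" where
  "curve_velocity U c v \<longleftrightarrow>
    (\<forall>s\<in>{0..1}. c s \<in> U \<and> (c has_vector_derivative v s) (at s within {0..1}))"

text \<open>
  \<open>W\<close> is parallel along the curve \<open>c\<close> with velocity \<open>v\<close>: its covariant derivative \<open>W' + \<Gamma>\<^bsub>c\<^esub>(v, W)\<close>
  vanishes.
\<close>

definition parallel_along ::
  "'a::euclidean_space set \<Rightarrow> 'a set \<Rightarrow> ('a \<Rightarrow> 'a \<Rightarrow> 'a \<Rightarrow> real) \<Rightarrow>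
    (real \<Rightarrow> 'a) \<Rightarrow> (real \<Rightarrow> 'a) \<Rightarrow> (real \<Rightarrow> 'a) \<Rightarrow> bool" where
  "parallel_along V U g c v W \<longleftrightarrow>
    (\<forall>s\<in>{0..1}. W s \<in> V \<and>
      (W has_vector_derivative - christoffel V U g (c s) (v s) (W s)) (at s within {0..1}))"

definition geodesic ::
  "'a::euclidean_space set \<Rightarrow> 'a set \<Rightarrow> ('a \<Rightarrow> 'a \<Rightarrow> 'a \<Rightarrow> real) \<Rightarrow>
    (real \<Rightarrow> 'a) \<Rightarrow> (real \<Rightarrow> 'a) \<Rightarrow> bool" where
  "geodesic V U g c v \<longleftrightarrow> curve_velocity U c v \<and> parallel_along V U g c v v"

definition riem_exp ::
  "'a::euclidean_space set \<Rightarrow> 'a set \<Rightarrow> ('a \<Rightarrow> 'a \<Rightarrow> 'a \<Rightarrow> real) \<Rightarrow> 'a \<Rightarrow> 'a \<Rightarrow> 'a option" where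
  "riem_exp V U g p X =
    the_unique (\<lambda>q. \<exists>c v. geodesic V U g c v \<and> c 0 = p \<and> v 0 = X \<and> c 1 = q)"

definition riem_log ::
  "'a::euclidean_space set \<Rightarrow> 'a set \<Rightarrow> ('a \<Rightarrow> 'a \<Rightarrow> 'a \<Rightarrow> real) \<Rightarrow> 'a \<Rightarrow> 'a \<Rightarrow> 'a option" where
  "riem_log V U g p q = the_unique (\<lambda>X. riem_exp V U g p X = Some q)"

text \<open>Parallel transport of \<open>W\<close> from \<open>p\<close> to \<open>q\<close> along the geodesic connecting \<open>p\<close> and \<open>q\<close>.\<close>

definition par_transport ::
  "'a::euclidean_space set \<Rightarrow> 'a set \<Rightarrow> ('a \<Rightarrow> 'a \<Rightarrow> 'a \<Rightarrow> real) \<Rightarrow> 'a \<Rightarrow> 'a \<Rightarrow> 'a \<Rightarrow> 'a option" where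
  "par_transport V U g p q W =
    the_unique (\<lambda>Z. \<exists>c v w. geodesic V U g c v \<and> c 0 = p \<and> c 1 = q
      \<and> parallel_along V U g c v w \<and> w 0 = W \<and> w 1 = Z)"

definition gyro_add ::
  "'a::euclidean_space set \<Rightarrow> 'a set \<Rightarrow> ('a \<Rightarrow> 'a \<Rightarrow> 'a \<Rightarrow> real) \<Rightarrow> 'a \<Rightarrow> 'a \<Rightarrow> 'a \<Rightarrow> 'a option" where
  "gyro_add V U g e p q =
    Option.bind (riem_log V U g e q) (\<lambda>X.
    Option.bind (par_transport V U g e p X) (\<lambda>Y.
    riem_exp V U g p Y))"

definition gyro_scale ::
  "'a::euclidean_space set \<Rightarrow> 'a set \<Rightarrow> ('a \<Rightarrow> 'a \<Rightarrow> 'a \<Rightarrow> real) \<Rightarrow> 'a \<Rightarrow> real \<Rightarrow> 'a \<Rightarrow> 'a option" where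
  "gyro_scale V U g e t p =
    Option.bind (riem_log V U g e p) (\<lambda>X. riem_exp V U g e (t *\<^sub>R X))"


section \<open>The Cholesky manifold and its metrics\<close>

text \<open>The index type is finite and linearly ordered, hence order-isomorphic to \<open>{1, \<dots>, n}\<close>.\<close>

type_synonym 'n sqmat = "((real, 'n) vec, 'n) vec"

definition lower_mats :: "('n::{finite,linorder} sqmat) set" where
  "lower_mats = {A. \<forall>i j. i < j \<longrightarrow> A $ i $ j = 0}"

definition pos_lower_mats :: "('n::{finite,linorder} sqmat) set" where
  "pos_lower_mats = {A \<in> lower_mats. \<forall>i. A $ i $ i > 0}"

definition pos_diag_mats :: "('n::finite sqmat) set" where
  "pos_diag_mats = {A. (\<forall>i j. i \<noteq> j \<longrightarrow> A $ i $ j = 0) \<and> (\<forall>i. A $ i $ i > 0)}"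

definition strict_lower :: "'n::{finite,linorder} sqmat \<Rightarrow> 'n sqmat" where
  "strict_lower A = (\<chi> i j. if j < i then A $ i $ j else 0)"

definition diag_part :: "'n::finite sqmat \<Rightarrow> 'n sqmat" where
  "diag_part A = (\<chi> i j. if i = j then A $ i $ j else 0)"

text \<open>Only meaningful for diagonal matrices with positive diagonal.\<close>

definition diag_powr :: "'n::finite sqmat \<Rightarrow> real \<Rightarrow> 'n sqmat" where
  "diag_powr D r = (\<chi> i j. if i = j then (D $ i $ i) powr r else 0)"

text \<open>The inner product of \<^typ>\<open>real^'n^'n\<close> is the Frobenius inner product.\<close>

definition dpm :: "real \<Rightarrow> 'n::{finite,linorder} sqmat \<Rightarrow> 'n sqmat \<Rightarrow> 'n sqmat \<Rightarrow> real" where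
  "dpm \<theta> L X Y =
     strict_lower X \<bullet> strict_lower Y
   + (diag_powr (diag_part L) (\<theta> - 1) ** diag_part X)
       \<bullet> (diag_powr (diag_part L) (\<theta> - 1) ** diag_part Y)"

definition dbwm ::
  "real \<Rightarrow> 'n::{finite,linorder} sqmat \<Rightarrow>
    'n sqmat \<Rightarrow> 'n sqmat \<Rightarrow> 'n sqmat \<Rightarrow> real" where
  "dbwm \<theta> M L X Y =
     strict_lower X \<bullet> strict_lower Y
   + 1 / 4 * ((diag_powr (diag_part L) (\<theta> - 2) ** diag_part X) \<bullet> (matrix_inv M ** diag_part Y))"

end

theory Submission
  imports Defs
begin

text \<open>
  Raising the diagonal entries to the power \<open>\<beta>\<close> is a chart of the Cholesky manifold in which both
  metrics have constant coefficients. Hence geodesics are straight line segments in this chart,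
  parallel fields are those with constant coordinates, and the gyro operations are the affine
  operations of a vector space with origin \<open>I\<close>, restricted to the matrices whose diagonal stays
  positive.
\<close>

section \<open>Unique existence and derivatives of matrix-valued curves\<close>

lemma the_unique_eq_Some_iff: "the_unique P = Some x \<longleftrightarrow> P x \<and> (\<forall>y. P y \<longrightarrow> y = x)"
proof (cases "\<exists>!x. P x")
  case True
  then obtain z where z: "P z" "\<And>y. P y \<Longrightarrow> y = z"
    by blast
  then have "(THE y. P y) = z"
    by (rule the_equality)
  with True have "the_unique P = Some z"
    by (simp add: the_unique_def)
  with z show ?thesis
    by (metis option.inject)
next
  case False
  then have "the_unique P = None"
    unfolding the_unique_def by (rule if_not_P)
  with False show ?thesis
    by (metis option.distinct(1))
qed

lemma the_unique_eqI: "P x \<Longrightarrow> (\<And>y. P y \<Longrightarrow> y = x) \<Longrightarrow> the_unique P = Some x"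
  unfolding the_unique_eq_Some_iff by blast

lemma the_unique_eq_None: "(\<And>x. \<not> P x) \<Longrightarrow> the_unique P = None"
  unfolding the_unique_def by (rule if_not_P) blast

text \<open>Inner products with the standard basis pick out the entries, so the calculus of matrix
  curves reduces to real functions.\<close>

lemma has_vector_derivative_matrix_iff:
  fixes f :: "real \<Rightarrow> real^'n^'m"
  shows "(f has_vector_derivative f') (at s within S) \<longleftrightarrow>
    (\<forall>i j. ((\<lambda>x. f x $ i $ j) has_real_derivative f' $ i $ j) (at s within S))"
  unfolding has_vector_derivative_def has_field_derivative_def
    has_derivative_componentwise_within[of f]
  by (simp add: Basis_vec_def inner_axis mult_commute_abs)

lemma vector_derivative_zero_const:
  fixes f :: "real \<Rightarrow> 'a::real_normed_vector"
  assumes "\<And>s. s \<in> {0..1} \<Longrightarrow> (f has_vector_derivative 0) (at s within {0..1})" "s \<in> {0..1}"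
  shows "f s = f 0"
  using assms has_derivative_zero_unique[of "{0..1}" f s 0]
  by (simp add: has_vector_derivative_def)

section \<open>The power chart\<close>

text \<open>Only diagonal entries are transformed, because both metrics are already Euclidean in the
  strictly lower ones.\<close>

definition chart :: "real \<Rightarrow> 'n::finite sqmat \<Rightarrow> 'n sqmat" where
  "chart r L = (\<chi> i j. if i = j then L $ i $ i powr r else L $ i $ j)"

text \<open>The differential of \<open>chart r\<close> at \<open>L\<close>, applied to
  \<open>X\<close>.\<close>

definition dchart :: "real \<Rightarrow> 'n::finite sqmat \<Rightarrow> 'n sqmat \<Rightarrow> 'n sqmat" where
  "dchart r L X = (\<chi> i j. if i = j then r * L $ i $ i powr (r - 1) * X $ i $ i else X $ i $ j)"

text \<open>For \<open>r \<noteq> 0\<close>, the Christoffel symbols of the flat connection pulled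
  back by \<open>chart r\<close>: \<open>(r - 1) / x\<close> is the second derivative of
  \<open>x powr r\<close> divided by the first.\<close>

definition diag_christoffel :: "real \<Rightarrow> 'n::finite sqmat \<Rightarrow> 'n sqmat \<Rightarrow> 'n sqmat \<Rightarrow> 'n sqmat" where
  "diag_christoffel r L X Y = (\<chi> i j. if i = j then (r - 1) * X $ i $ i * Y $ i $ i / L $ i $ i else 0)"

section \<open>Lower triangular matrices and positivity of the diagonal\<close>

lemma pos_lower_mats_subset: "L \<in> pos_lower_mats \<Longrightarrow> L \<in> lower_mats"
  by (simp add: pos_lower_mats_def)

lemma lower_mats_add: "X \<in> lower_mats \<Longrightarrow> Y \<in> lower_mats \<Longrightarrow> X + Y \<in> lower_mats"
  and lower_mats_diff: "X \<in> lower_mats \<Longrightarrow> Y \<in> lower_mats \<Longrightarrow> X - Y \<in> lower_mats"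
  and lower_mats_scaleR: "X \<in> lower_mats \<Longrightarrow> a *\<^sub>R X \<in> lower_mats"
  by (auto simp: lower_mats_def)

lemma mat_1_pos_lower: "(mat 1 :: 'n::{finite,linorder} sqmat) \<in> pos_lower_mats"
  by (auto simp: pos_lower_mats_def lower_mats_def mat_def)

text \<open>This keeps the straight segment between two chart values inside the image of the
  chart.\<close>

lemma convex_pos_lower_mats: "convex (pos_lower_mats :: 'n::{finite,linorder} sqmat set)"
proof (rule convexI)
  fix L K :: "'n sqmat" and u v :: real
  assume *: "L \<in> pos_lower_mats" "K \<in> pos_lower_mats" "0 \<le> u" "0 \<le> v" "u + v = 1"
  then have "u *\<^sub>R L $ i $ i + v *\<^sub>R K $ i $ i \<in> {0<..}" for i
    by (intro convexD[OF convex_real_interval(3)]) (simp_all add: pos_lower_mats_def)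
  then show "u *\<^sub>R L + v *\<^sub>R K \<in> pos_lower_mats"
    using * by (simp add: pos_lower_mats_def lower_mats_def)
qed

text \<open>Finitely many strict inequalities persist near \<open>s = 0\<close>. The formula for the
  metric is available on \<open>pos_lower_mats\<close> only, so differentiating it needs such a
  neighbourhood.\<close>

lemma eventually_pos_lower:
  fixes p Z :: "'n::{finite,linorder} sqmat"
  assumes "p \<in> pos_lower_mats" "Z \<in> lower_mats"
  shows "eventually (\<lambda>s. p + s *\<^sub>R Z \<in> pos_lower_mats) (nhds (0::real))"
proof -
  have "eventually (\<lambda>s::real. p $ i $ i + s * Z $ i $ i > 0) (nhds 0)" for i
  proof -
    have "((\<lambda>s::real. p $ i $ i + s * Z $ i $ i) \<longlongrightarrow> p $ i $ i + 0 * Z $ i $ i) (nhds 0)"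
      by (intro tendsto_intros filterlim_ident)
    moreover have "p $ i $ i + 0 * Z $ i $ i > 0"
      using assms by (simp add: pos_lower_mats_def)
    ultimately show ?thesis
      by (rule order_tendstoD)
  qed
  then have "eventually (\<lambda>s::real. \<forall>i. p $ i $ i + s * Z $ i $ i > 0) (nhds 0)"
    by (rule eventually_all_finite)
  then show ?thesis
    by eventually_elim (use assms in \<open>auto simp: pos_lower_mats_def lower_mats_def\<close>)
qed

section \<open>The chart, its inverse and their differentials\<close>

lemma chart_mat_1 [simp]: "chart r (mat 1) = mat 1"
  by (simp add: chart_def mat_def vec_eq_iff)

lemma chart_pos_lower: "L \<in> pos_lower_mats \<Longrightarrow> chart r L \<in> pos_lower_mats"
  by (auto simp: pos_lower_mats_def lower_mats_def chart_def less_le)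

lemma chart_inverse:
  "r \<noteq> 0 \<Longrightarrow> L \<in> pos_lower_mats \<Longrightarrow> chart (1 / r) (chart r L) = L"
  "r \<noteq> 0 \<Longrightarrow> L \<in> pos_lower_mats \<Longrightarrow> chart r (chart (1 / r) L) = L"
  by (auto simp: pos_lower_mats_def chart_def vec_eq_iff powr_powr less_imp_le)

lemma dchart_lower: "X \<in> lower_mats \<Longrightarrow> dchart r L X \<in> lower_mats"
  by (auto simp: lower_mats_def dchart_def)

lemma dchart_scaleR: "dchart r L (a *\<^sub>R X) = a *\<^sub>R dchart r L X"
  by (simp add: dchart_def vec_eq_iff)

text \<open>Chain rule for two mutually inverse charts: on the diagonal the factors \<open>r\<close>
  and \<open>1 / r\<close> cancel, and so do the two powers.\<close>

lemma dchart_inverse: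
  assumes "r \<noteq> 0" "L \<in> pos_lower_mats"
  shows "dchart (1 / r) (chart r L) (dchart r L X) = X"
    and "dchart r L (dchart (1 / r) (chart r L) X) = X"
proof -
  have "r * (1 / r - 1) + (r - 1) = 0"
    using assms by (simp add: field_simps)
  then have "(x powr r) powr (1 / r - 1) * x powr (r - 1) = 1" if "x > 0" for x :: real
    using that by (simp add: powr_powr flip: powr_add)
  then show "dchart (1 / r) (chart r L) (dchart r L X) = X"
    and "dchart r L (dchart (1 / r) (chart r L) X) = X"
    using assms by (auto simp: pos_lower_mats_def chart_def dchart_def vec_eq_iff mult_ac)
qed

lemma chart_has_vector_derivative:
  assumes "(c has_vector_derivative v) (at s within S)" "c s \<in> pos_lower_mats"
  shows "((\<lambda>s. chart r (c s)) has_vector_derivative dchart r (c s) v) (at s within S)"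
  using assms unfolding has_vector_derivative_matrix_iff
  by (auto simp: chart_def dchart_def pos_lower_mats_def intro!: derivative_eq_intros)

text \<open>The right-hand side is \<open>dchart\<close> applied to the covariant derivative of \<open>w\<close> along \<open>c\<close>.\<close>

lemma dchart_has_vector_derivative:
  assumes c: "(c has_vector_derivative v) (at s within S)" "c s \<in> pos_lower_mats"
    and w: "(w has_vector_derivative w') (at s within S)"
  shows "((\<lambda>s. dchart r (c s) (w s)) has_vector_derivative
    dchart r (c s) (w' + diag_christoffel r (c s) v (w s))) (at s within S)"
proof -
  \<comment> \<open>Differentiating \<open>x powr (r - 1)\<close> lowers the exponent to
    \<open>r - 2\<close>; written as a quotient by \<open>x\<close> it matches
    \<open>diag_christoffel\<close>.\<close>
  have *: "x powr (r - 2) = x powr (r - 1) / x" if "x > 0" for x :: real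
    using that powr_diff[of x "r - 1" 1] by simp
  have "c s $ i $ i \<noteq> 0" for i
    using c(2) by (auto simp: pos_lower_mats_def less_le)
  note field_eqs = this *
  show ?thesis
    using assms unfolding has_vector_derivative_matrix_iff
    by (auto simp: dchart_def diag_christoffel_def pos_lower_mats_def field_eqs field_simps
        intro!: derivative_eq_intros)
qed

section \<open>Metrics with constant coefficients in the power chart\<close>

text \<open>Common form of both metrics. The weight \<open>a i * x powr (2 * \<beta> - 2)\<close> is
  a constant multiple of the squared derivative of \<open>x powr \<beta>\<close>, hence constant in
  \<open>chart \<beta>\<close>.\<close>

locale diag_power_metric =
  fixes \<beta> :: real and a :: "'n::{finite,linorder} \<Rightarrow> real"
    and g :: "'n sqmat \<Rightarrow> 'n sqmat \<Rightarrow> 'n sqmat \<Rightarrow> real"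
  assumes \<beta>: "\<beta> \<noteq> 0" and a_pos: "a i > 0"
    and g_eq: "L \<in> pos_lower_mats \<Longrightarrow> g L X Y = strict_lower X \<bullet> strict_lower Y
      + (\<Sum>i\<in>UNIV. a i * L $ i $ i powr (2 * \<beta> - 2) * X $ i $ i * Y $ i $ i)"
begin

section \<open>Bilinearity, definiteness and the Levi-Civita connection\<close>

lemma g_add: "L \<in> pos_lower_mats \<Longrightarrow> g L (X + Y) Z = g L X Z + g L Y Z"
proof -
  assume "L \<in> pos_lower_mats"
  moreover have "strict_lower (X + Y) = strict_lower X + strict_lower Y"
    by (simp add: strict_lower_def vec_eq_iff)
  ultimately show "g L (X + Y) Z = g L X Z + g L Y Z"
    by (simp add: g_eq inner_add_left algebra_simps sum.distrib)
qed

lemma g_diff: "L \<in> pos_lower_mats \<Longrightarrow> g L (X - Y) Z = g L X Z - g L Y Z"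
  using g_add[of L "X - Y" Y Z] by simp

lemma g_commute: "L \<in> pos_lower_mats \<Longrightarrow> g L X Y = g L Y X"
  by (simp add: g_eq inner_commute mult_ac)

lemma g_definite:
  assumes "L \<in> pos_lower_mats" "X \<in> lower_mats" "g L X X = 0"
  shows "X = 0"
proof -
  have nn: "a i * L $ i $ i powr (2 * \<beta> - 2) * X $ i $ i * X $ i $ i \<ge> 0" for i
    using a_pos[of i] by (simp add: mult.assoc)
  have "strict_lower X \<bullet> strict_lower X = 0"
    and sum0: "(\<Sum>i\<in>UNIV. a i * L $ i $ i powr (2 * \<beta> - 2) * X $ i $ i * X $ i $ i) = 0"
    using assms(1,3) nn by (simp_all add: g_eq add_nonneg_eq_0_iff sum_nonneg)
  then have s: "strict_lower X = 0"
    by simp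
  have "a i * L $ i $ i powr (2 * \<beta> - 2) * X $ i $ i * X $ i $ i = 0" for i
    using sum0 nn by (simp add: sum_nonneg_eq_0_iff)
  moreover have "L $ i $ i \<noteq> 0" "a i \<noteq> 0" for i
    using assms(1) a_pos[of i] by (auto simp: pos_lower_mats_def less_le)
  ultimately have d: "X $ i $ i = 0" for i
    by (metis mult_eq_0_iff powr_eq_0_iff)
  have "X $ i $ j = 0" for i j
  proof (cases i j rule: linorder_cases)
    case greater
    then have "X $ i $ j = strict_lower X $ i $ j"
      by (simp add: strict_lower_def)
    then show ?thesis
      by (simp add: s)
  qed (use d assms(2) in \<open>auto simp: lower_mats_def\<close>)
  then show ?thesis
    by (simp add: vec_eq_iff)
qed

text \<open>Differentiating \<open>x powr (2 * \<beta> - 2)\<close> in direction \<open>z\<close>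
  multiplies it by \<open>2 * (\<beta> - 1) * z / x\<close>; each of the two Christoffel terms in
  the compatibility condition supplies half of this.\<close>

lemma is_levi_civita_diag_christoffel:
  "is_levi_civita lower_mats pos_lower_mats g (diag_christoffel \<beta>)"
  unfolding is_levi_civita_def
proof (intro ballI conjI allI)
  fix p X Y Z :: "'n sqmat"
  assume p: "p \<in> pos_lower_mats" and X: "X \<in> lower_mats" and Y: "Y \<in> lower_mats"
    and Z: "Z \<in> lower_mats"
  show "diag_christoffel \<beta> p X Y \<in> lower_mats"
    by (auto simp: diag_christoffel_def lower_mats_def)
  show "diag_christoffel \<beta> p X (a *\<^sub>R Y + b *\<^sub>R Z)
      = a *\<^sub>R diag_christoffel \<beta> p X Y + b *\<^sub>R diag_christoffel \<beta> p X Z" for a b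
    by (simp add: diag_christoffel_def vec_eq_iff distrib_left add_divide_distrib mult_ac)
  show "diag_christoffel \<beta> p X Y = diag_christoffel \<beta> p Y X"
    by (simp add: diag_christoffel_def vec_eq_iff mult_ac)
  \<comment> \<open>The explicit formula for \<open>g (p + s *\<^sub>R Z) X Y\<close>, to be
    differentiated termwise; agreement near \<open>s = 0\<close> is enough for the derivative at
    0.\<close>
  define h where "h s = strict_lower X \<bullet> strict_lower Y
    + (\<Sum>i\<in>UNIV. a i * (p $ i $ i + s * Z $ i $ i) powr (2 * \<beta> - 2) * X $ i $ i * Y $ i $ i)" for s
  have pii: "p $ i $ i > 0" for i
    using p by (simp add: pos_lower_mats_def)
  have pow: "p $ i $ i powr (2 * \<beta> - 2 - 1) = p $ i $ i powr (2 * \<beta> - 2) / p $ i $ i" for i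
    using pii[of i] powr_diff[of "p $ i $ i" "2 * \<beta> - 2" 1] by simp
  have strict: "strict_lower (diag_christoffel \<beta> p X Y) = 0" for X Y
    by (simp add: strict_lower_def diag_christoffel_def vec_eq_iff)
  have "((\<lambda>s. (p $ i $ i + s * Z $ i $ i) powr (2 * \<beta> - 2)) has_real_derivative
      (2 * \<beta> - 2) * p $ i $ i powr (2 * \<beta> - 2 - 1) * Z $ i $ i) (at 0)" for i
    using pii[of i] by (auto intro!: derivative_eq_intros)
  note DERIV_cmult_right[OF DERIV_cmult_right[OF DERIV_cmult[OF this]]]
  then have "(h has_real_derivative
      (\<Sum>i\<in>UNIV. a i * ((2 * \<beta> - 2) * p $ i $ i powr (2 * \<beta> - 2 - 1) * Z $ i $ i)
        * X $ i $ i * Y $ i $ i)) (at 0)"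
    unfolding h_def by (rule DERIV_add[OF DERIV_const DERIV_sum, THEN DERIV_cong]) simp
  also have "(\<Sum>i\<in>UNIV. a i * ((2 * \<beta> - 2) * p $ i $ i powr (2 * \<beta> - 2 - 1) * Z $ i $ i)
        * X $ i $ i * Y $ i $ i) =
      g p (diag_christoffel \<beta> p Z X) Y + g p X (diag_christoffel \<beta> p Z Y)"
    unfolding g_eq[OF p] strict pow
    by (simp add: diag_christoffel_def algebra_simps add_divide_distrib diff_divide_distrib
        flip: sum.distrib)
  finally have "(h has_real_derivative
      g p (diag_christoffel \<beta> p Z X) Y + g p X (diag_christoffel \<beta> p Z Y)) (at 0)" .
  moreover have "eventually (\<lambda>s. g (p + s *\<^sub>R Z) X Y = h s) (nhds 0)"
    using eventually_pos_lower[OF p Z] by eventually_elim (simp add: g_eq h_def)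
  ultimately show "((\<lambda>s. g (p + s *\<^sub>R Z) X Y) has_real_derivative
      g p (diag_christoffel \<beta> p Z X) Y + g p X (diag_christoffel \<beta> p Z Y)) (at 0)"
    by (subst DERIV_cong_ev[OF refl _ refl])
qed

text \<open>
  Uniqueness: the difference \<open>D\<close> of two Levi-Civita connections makes \<open>g(D(X, Y), Z)\<close> symmetric in
  \<open>X, Y\<close> and antisymmetric in \<open>Y, Z\<close>, hence zero.
\<close>

lemma christoffel_eq:
  assumes p: "p \<in> pos_lower_mats" and X: "X \<in> lower_mats" and Y: "Y \<in> lower_mats"
  shows "christoffel lower_mats pos_lower_mats g p X Y = diag_christoffel \<beta> p X Y"
proof -
  define \<Gamma> where "\<Gamma> = christoffel lower_mats pos_lower_mats g"
  \<comment> \<open>\<open>christoffel\<close> is a \<open>SOME\<close> choice; the witness just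
    constructed ensures that the choice is a Levi-Civita connection.\<close>
  have \<Gamma>: "is_levi_civita lower_mats pos_lower_mats g \<Gamma>"
    unfolding \<Gamma>_def christoffel_def
    by (rule someI[where P = "is_levi_civita lower_mats pos_lower_mats g",
          OF is_levi_civita_diag_christoffel])
  define D where "D X Y = \<Gamma> p X Y - diag_christoffel \<beta> p X Y" for X Y
  define T where "T X Y Z = g p (D X Y) Z" for X Y Z
  have D_lower: "D X Y \<in> lower_mats" if "X \<in> lower_mats" "Y \<in> lower_mats" for X Y
    using \<Gamma> is_levi_civita_diag_christoffel p that unfolding is_levi_civita_def D_def
    by (intro lower_mats_diff) blast+
  have sym: "T X Y Z = T Y X Z" if "X \<in> lower_mats" "Y \<in> lower_mats" for X Y Z
  proof -
    have "\<Gamma> p X Y = \<Gamma> p Y X" "diag_christoffel \<beta> p X Y = diag_christoffel \<beta> p Y X"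
      using \<Gamma> is_levi_civita_diag_christoffel p that unfolding is_levi_civita_def by blast+
    then show ?thesis
      by (simp add: T_def D_def)
  qed
  have skew: "T Z X Y = - T Z Y X"
    if "X \<in> lower_mats" "Y \<in> lower_mats" "Z \<in> lower_mats" for X Y Z
  proof -
    have "((\<lambda>s. g (p + s *\<^sub>R Z) X Y) has_real_derivative
        (g p (\<Gamma> p Z X) Y + g p X (\<Gamma> p Z Y))) (at 0)"
      "((\<lambda>s. g (p + s *\<^sub>R Z) X Y) has_real_derivative
        (g p (diag_christoffel \<beta> p Z X) Y + g p X (diag_christoffel \<beta> p Z Y))) (at 0)"
      using \<Gamma> is_levi_civita_diag_christoffel p that unfolding is_levi_civita_def by blast+
    then have "g p (\<Gamma> p Z X) Y + g p X (\<Gamma> p Z Y) =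
        g p (diag_christoffel \<beta> p Z X) Y + g p X (diag_christoffel \<beta> p Z Y)"
      by (rule DERIV_unique)
    then show ?thesis
      unfolding T_def D_def g_diff[OF p] by (simp add: g_commute[OF p, of X])
  qed
  \<comment> \<open>Alternating the two rules gives \<open>T X Y Z = - T X Z Y = - T Z X Y = T Z Y X
    = T Y Z X = - T Y X Z = - T X Y Z\<close>.\<close>
  have "T X Y Z = 0" if "X \<in> lower_mats" "Y \<in> lower_mats" "Z \<in> lower_mats" for X Y Z
    using sym skew that by (smt (verit, best))
  then have "g p (D X Y) (D X Y) = 0"
    using D_lower X Y unfolding T_def by blast
  then have "D X Y = 0"
    using g_definite p D_lower X Y by blast
  then show ?thesis
    by (simp add: D_def \<Gamma>_def)
qed

section \<open>Parallel fields and geodesics in chart coordinates\<close>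

abbreviation "par \<equiv> parallel_along lower_mats pos_lower_mats g"
abbreviation "geo \<equiv> geodesic lower_mats pos_lower_mats g"

text \<open>The chart coordinates of \<open>w\<close> have as derivative the \<open>dchart\<close>
  of its covariant derivative, which vanishes.\<close>

lemma parallel_dchart_const:
  assumes geo: "geo c v" and par: "par c v w" and s: "s \<in> {0..1}"
  shows "dchart \<beta> (c s) (w s) = dchart \<beta> (c 0) (w 0)"
proof -
  have "((\<lambda>s. dchart \<beta> (c s) (w s)) has_vector_derivative 0) (at s within {0..1})"
    if s: "s \<in> {0..1}" for s
  proof -
    have "c s \<in> pos_lower_mats" "(c has_vector_derivative v s) (at s within {0..1})"
      "v s \<in> lower_mats" "w s \<in> lower_mats"
      "(w has_vector_derivative - christoffel lower_mats pos_lower_mats g (c s) (v s) (w s))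
        (at s within {0..1})"
      using geo par s by (auto simp: geodesic_def curve_velocity_def parallel_along_def)
    moreover from this have "(w has_vector_derivative - diag_christoffel \<beta> (c s) (v s) (w s))
        (at s within {0..1})"
      by (simp add: christoffel_eq)
    ultimately have "((\<lambda>s. dchart \<beta> (c s) (w s)) has_vector_derivative dchart \<beta> (c s) 0)
        (at s within {0..1})"
      using dchart_has_vector_derivative[of c "v s" s "{0..1}" w _ \<beta>] by fastforce
    then show ?thesis
      using dchart_scaleR[of \<beta> "c s" 0 0] by simp
  qed
  then show ?thesis
    using s by (rule vector_derivative_zero_const)
qed

text \<open>The velocity of a geodesic is parallel, so in the chart the curve moves with constant
  velocity for unit time.\<close>

lemma geodesic_chart_end:
  assumes geo: "geo c v"
  shows "chart \<beta> (c 1) = chart \<beta> (c 0) + dchart \<beta> (c 0) (v 0)"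
proof -
  let ?Y = "dchart \<beta> (c 0) (v 0)"
  have "((\<lambda>s. chart \<beta> (c s) - s *\<^sub>R ?Y) has_vector_derivative 0) (at s within {0..1})"
    if s: "s \<in> {0..1}" for s
  proof -
    have "c s \<in> pos_lower_mats" "(c has_vector_derivative v s) (at s within {0..1})"
      using geo s by (auto simp: geodesic_def curve_velocity_def)
    then have "((\<lambda>s. chart \<beta> (c s)) has_vector_derivative dchart \<beta> (c s) (v s))
        (at s within {0..1})"
      by (intro chart_has_vector_derivative)
    moreover have "dchart \<beta> (c s) (v s) = ?Y"
      using geo s by (intro parallel_dchart_const) (auto simp: geodesic_def)
    ultimately show ?thesis
      by (auto intro!: derivative_eq_intros)
  qed
  from vector_derivative_zero_const[OF this, of 1] show ?thesis
    by (simp add: algebra_simps)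
qed

text \<open>Converse direction: a straight segment and a constant vector \<open>Z\<close> in the
  chart are pulled back by \<open>chart (1 / \<beta>)\<close> and its differential. Convexity keeps
  the segment in the image. For \<open>Z = Y\<close> the field is \<open>v\<close>, which makes
  \<open>c\<close> a geodesic.\<close>

lemma parallel_chart_line:
  assumes p: "p \<in> pos_lower_mats" and q: "q \<in> pos_lower_mats"
    and Y: "Y = chart \<beta> q - chart \<beta> p" and Z: "Z \<in> lower_mats"
  defines "line \<equiv> \<lambda>s. chart \<beta> p + s *\<^sub>R Y"
  defines "c \<equiv> \<lambda>s. chart (1 / \<beta>) (line s)"
  defines "v \<equiv> \<lambda>s. dchart (1 / \<beta>) (line s) Y"
  shows "curve_velocity pos_lower_mats c v"
    and "par c v (\<lambda>s. dchart (1 / \<beta>) (line s) Z)"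
proof -
  have Y_lower: "Y \<in> lower_mats"
    unfolding Y using p q by (intro lower_mats_diff pos_lower_mats_subset chart_pos_lower)
  have line: "line s \<in> pos_lower_mats" if "s \<in> {0..1}" for s
  proof -
    have "line s = (1 - s) *\<^sub>R chart \<beta> p + s *\<^sub>R chart \<beta> q"
      by (simp add: line_def Y algebra_simps)
    then show ?thesis
      using convexD_alt[OF convex_pos_lower_mats chart_pos_lower[OF p] chart_pos_lower[OF q]] that
      by simp
  qed
  have line': "(line has_vector_derivative Y) (at s within {0..1})" for s
    unfolding line_def by (auto intro!: derivative_eq_intros)
  have c_pos: "c s \<in> pos_lower_mats" if "s \<in> {0..1}" for s
    unfolding c_def using that line chart_pos_lower by blast
  show vel: "curve_velocity pos_lower_mats c v"
    unfolding curve_velocity_def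
    using c_pos chart_has_vector_derivative[OF line' line] by (simp add: c_def v_def)
  \<comment> \<open>Both sides are the second derivative of the inverse chart in directions
    \<open>Y\<close> and \<open>Z\<close>; the equality is what differentiating
    \<open>chart \<beta> (chart (1 / \<beta>) L) = L\<close> twice gives.\<close>
  have \<Gamma>: "dchart (1 / \<beta>) (line s) (diag_christoffel (1 / \<beta>) (line s) Y Z)
      = - diag_christoffel \<beta> (c s) (v s) (dchart (1 / \<beta>) (line s) Z)" if "s \<in> {0..1}" for s
  proof -
    have "(1 / \<beta>) * x powr (1 / \<beta> - 1) * ((1 / \<beta> - 1) * y * z / x)
        = - ((\<beta> - 1) * ((1 / \<beta>) * x powr (1 / \<beta> - 1) * y) * ((1 / \<beta>) * x powr (1 / \<beta> - 1) * z)
            / x powr (1 / \<beta>))" if "x > 0" for x y z :: real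
    proof -
      \<comment> \<open>\<open>P\<close> stands for \<open>x powr (1 / \<beta>)\<close>, which
        leaves an identity of rational functions.\<close>
      have "(1 / \<beta>) * (P / x) * ((1 / \<beta> - 1) * y * z / x)
          = - ((\<beta> - 1) * ((1 / \<beta>) * (P / x) * y) * ((1 / \<beta>) * (P / x) * z) / P)"
        if "P > 0" for P
        using that \<beta> \<open>x > 0\<close> by (simp add: field_simps)
      moreover have "x powr (1 / \<beta> - 1) = x powr (1 / \<beta>) / x" "x powr (1 / \<beta>) > 0"
        using that by (simp_all add: powr_diff)
      ultimately show ?thesis
        by (simp only:)
    qed
    then show ?thesis
      using line[OF that]
      by (simp add: pos_lower_mats_def c_def v_def dchart_def diag_christoffel_def chart_def vec_eq_iff)
  qed
  show "par c v (\<lambda>s. dchart (1 / \<beta>) (line s) Z)"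
    unfolding parallel_along_def
  proof (intro ballI conjI)
    fix s :: real assume s: "s \<in> {0..1}"
    show W: "dchart (1 / \<beta>) (line s) Z \<in> lower_mats"
      using Z by (rule dchart_lower)
    have "((\<lambda>s. dchart (1 / \<beta>) (line s) Z) has_vector_derivative
        dchart (1 / \<beta>) (line s) (0 + diag_christoffel (1 / \<beta>) (line s) Y Z)) (at s within {0..1})"
      by (rule dchart_has_vector_derivative[OF line' line[OF s]]) simp
    moreover have "v s \<in> lower_mats"
      unfolding v_def using Y_lower by (rule dchart_lower)
    ultimately show "((\<lambda>s. dchart (1 / \<beta>) (line s) Z) has_vector_derivative
        - christoffel lower_mats pos_lower_mats g (c s) (v s) (dchart (1 / \<beta>) (line s) Z))
        (at s within {0..1})"
      using \<Gamma>[OF s] W by (simp add: christoffel_eq[OF c_pos[OF s]])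
  qed
qed

lemma parallel_transport_exists:
  assumes p: "p \<in> pos_lower_mats" and q: "q \<in> pos_lower_mats"
    and X: "dchart \<beta> p X = chart \<beta> q - chart \<beta> p"
    and W: "W \<in> lower_mats" and Z: "dchart \<beta> q Z = dchart \<beta> p W"
  obtains c v w where "geo c v" "c 0 = p" "c 1 = q" "v 0 = X" "par c v w" "w 0 = W" "w 1 = Z"
proof
  define line where "line s = chart \<beta> p + s *\<^sub>R (chart \<beta> q - chart \<beta> p)" for s :: real
  define c where "c s = chart (1 / \<beta>) (line s)" for s
  define v where "v s = dchart (1 / \<beta>) (line s) (dchart \<beta> p X)" for s
  define w where "w s = dchart (1 / \<beta>) (line s) (dchart \<beta> p W)" for s
  have "dchart \<beta> p X \<in> lower_mats"
    unfolding X using p q by (intro lower_mats_diff pos_lower_mats_subset chart_pos_lower)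
  \<comment> \<open>Once for the velocity itself, giving the geodesic, and once for the field that
    starts at \<open>W\<close>.\<close>
  note * = parallel_chart_line[OF p q X this] parallel_chart_line[OF p q X dchart_lower[OF W]]
  show "geo c v" "par c v w"
    using * unfolding geodesic_def c_def v_def w_def line_def X by simp_all
  have "line 0 = chart \<beta> p" "line 1 = chart \<beta> q"
    by (simp_all add: line_def)
  then show "c 0 = p" "c 1 = q" "v 0 = X" "w 0 = W" "w 1 = Z"
    using p q \<beta> dchart_inverse(1)[OF \<beta> q, of Z]
    by (simp_all add: c_def v_def w_def chart_inverse dchart_inverse Z)
qed

text \<open>Geodesics are affine in the chart, so their existence becomes an equation between end
  points and initial velocity. By convexity, positivity at the two ends suffices.\<close>

lemma geodesic_iff:
  "(\<exists>c v. geo c v \<and> c 0 = p \<and> v 0 = X \<and> c 1 = q) \<longleftrightarrow>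
    p \<in> pos_lower_mats \<and> q \<in> pos_lower_mats \<and> X \<in> lower_mats \<and>
    chart \<beta> q = chart \<beta> p + dchart \<beta> p X"
proof (intro iffI; elim exE conjE)
  fix c v assume *: "geo c v" "c 0 = p" "v 0 = X" "c 1 = q"
  then show "p \<in> pos_lower_mats \<and> q \<in> pos_lower_mats \<and> X \<in> lower_mats \<and>
      chart \<beta> q = chart \<beta> p + dchart \<beta> p X"
    using geodesic_chart_end[OF *(1)]
    by (force simp: geodesic_def curve_velocity_def parallel_along_def)
next
  assume *: "p \<in> pos_lower_mats" "q \<in> pos_lower_mats" "X \<in> lower_mats"
    "chart \<beta> q = chart \<beta> p + dchart \<beta> p X"
  then have "dchart \<beta> p X = chart \<beta> q - chart \<beta> p"
    by simp
  \<comment> \<open>The existence result also asks for a transported vector at \<open>q\<close>;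
    this one has the coordinates of \<open>X\<close>.\<close>
  moreover have "dchart \<beta> q (dchart (1 / \<beta>) (chart \<beta> q) (dchart \<beta> p X)) = dchart \<beta> p X"
    using \<beta> *(2) by (rule dchart_inverse)
  ultimately show "\<exists>c v. geo c v \<and> c 0 = p \<and> v 0 = X \<and> c 1 = q"
    using * parallel_transport_exists by metis
qed

section \<open>Exponential, logarithm, parallel transport and gyro operations\<close>

lemma chart_inj: "p \<in> pos_lower_mats \<Longrightarrow> q \<in> pos_lower_mats \<Longrightarrow> chart \<beta> p = chart \<beta> q \<Longrightarrow> p = q"
  using \<beta> chart_inverse(1) by metis

text \<open>The chart value of the end point determines it. The geodesic lasts until time 1 exactly
  when this value lies in \<open>pos_lower_mats\<close>, which is the image of the chart.\<close>

lemma riem_exp_eq: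
  assumes p: "p \<in> pos_lower_mats" and X: "X \<in> lower_mats"
  shows "riem_exp lower_mats pos_lower_mats g p X =
    (if chart \<beta> p + dchart \<beta> p X \<in> pos_lower_mats
     then Some (chart (1 / \<beta>) (chart \<beta> p + dchart \<beta> p X)) else None)"
proof (cases "chart \<beta> p + dchart \<beta> p X \<in> pos_lower_mats")
  case True
  have "riem_exp lower_mats pos_lower_mats g p X =
      Some (chart (1 / \<beta>) (chart \<beta> p + dchart \<beta> p X))"
    unfolding riem_exp_def geodesic_iff
  proof (rule the_unique_eqI)
    show *: "p \<in> pos_lower_mats \<and> chart (1 / \<beta>) (chart \<beta> p + dchart \<beta> p X) \<in> pos_lower_mats \<and>
        X \<in> lower_mats \<and>
        chart \<beta> (chart (1 / \<beta>) (chart \<beta> p + dchart \<beta> p X)) = chart \<beta> p + dchart \<beta> p X"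
      using assms True \<beta> by (simp add: chart_inverse chart_pos_lower)
    show "q = chart (1 / \<beta>) (chart \<beta> p + dchart \<beta> p X)"
      if "p \<in> pos_lower_mats \<and> q \<in> pos_lower_mats \<and> X \<in> lower_mats \<and>
        chart \<beta> q = chart \<beta> p + dchart \<beta> p X" for q
      using that * chart_inj by metis
  qed
  with True show ?thesis
    by simp
next
  case False
  have "riem_exp lower_mats pos_lower_mats g p X = None"
    unfolding riem_exp_def geodesic_iff
    by (rule the_unique_eq_None) (use False chart_pos_lower in metis)
  with False show ?thesis
    by simp
qed

text \<open>The equation \<open>chart \<beta> q = chart \<beta> p + dchart \<beta> p X\<close> has a
  unique solution \<open>X\<close>, since \<open>dchart \<beta> p\<close> is invertible.\<close>

lemma riem_log_eq:
  assumes p: "p \<in> pos_lower_mats" and q: "q \<in> pos_lower_mats"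
  shows "riem_log lower_mats pos_lower_mats g p q =
    Some (dchart (1 / \<beta>) (chart \<beta> p) (chart \<beta> q - chart \<beta> p))" (is "_ = Some ?X")
  unfolding riem_log_def
proof (rule the_unique_eqI)
  have "chart \<beta> q - chart \<beta> p \<in> lower_mats"
    using p q by (intro lower_mats_diff pos_lower_mats_subset chart_pos_lower)
  then have "?X \<in> lower_mats"
    by (rule dchart_lower)
  then show "riem_exp lower_mats pos_lower_mats g p ?X = Some q"
    using p q \<beta> by (simp add: riem_exp_eq dchart_inverse chart_inverse chart_pos_lower)
  fix X assume "riem_exp lower_mats pos_lower_mats g p X = Some q"
  then have "chart \<beta> q = chart \<beta> p + dchart \<beta> p X"
    unfolding riem_exp_def geodesic_iff the_unique_eq_Some_iff by blast
  then show "X = ?X"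
    using p \<beta> by (simp add: dchart_inverse)
qed

text \<open>Every geodesic joining \<open>p\<close> and \<open>q\<close> preserves the chart
  coordinates of a parallel field, so the transported vector is unique.\<close>

lemma par_transport_eq:
  assumes p: "p \<in> pos_lower_mats" and q: "q \<in> pos_lower_mats" and W: "W \<in> lower_mats"
  shows "par_transport lower_mats pos_lower_mats g p q W =
    Some (dchart (1 / \<beta>) (chart \<beta> q) (dchart \<beta> p W))"
  unfolding par_transport_def
proof (rule the_unique_eqI)
  have "dchart \<beta> p (dchart (1 / \<beta>) (chart \<beta> p) (chart \<beta> q - chart \<beta> p)) = chart \<beta> q - chart \<beta> p"
    "dchart \<beta> q (dchart (1 / \<beta>) (chart \<beta> q) (dchart \<beta> p W)) = dchart \<beta> p W"
    using p q \<beta> by (simp_all add: dchart_inverse)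
  from parallel_transport_exists[OF p q this(1) W this(2)]
  show "\<exists>c v w. geo c v \<and> c 0 = p \<and> c 1 = q \<and> par c v w \<and> w 0 = W \<and>
      w 1 = dchart (1 / \<beta>) (chart \<beta> q) (dchart \<beta> p W)"
    by metis
  fix Z
  assume "\<exists>c v w. geo c v \<and> c 0 = p \<and> c 1 = q \<and> par c v w \<and> w 0 = W \<and> w 1 = Z"
  then obtain c v w where "geo c v" "c 0 = p" "c 1 = q" "par c v w" "w 0 = W" "w 1 = Z"
    by blast
  then have "dchart \<beta> q Z = dchart \<beta> p W"
    using parallel_dchart_const[of c v w 1] by simp
  then show "Z = dchart (1 / \<beta>) (chart \<beta> q) (dchart \<beta> p W)"
    using q \<beta> dchart_inverse(1) by metis
qed

text \<open>The logarithm has coordinates \<open>chart \<beta> q - chart \<beta> e\<close>,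
  transport keeps them, and the exponential adds them to \<open>chart \<beta> p\<close>. Only this
  last operation can be undefined.\<close>

lemma gyro_add_eq:
  assumes e: "e \<in> pos_lower_mats" and p: "p \<in> pos_lower_mats" and q: "q \<in> pos_lower_mats"
  shows "gyro_add lower_mats pos_lower_mats g e p q =
    (if chart \<beta> p + (chart \<beta> q - chart \<beta> e) \<in> pos_lower_mats
     then Some (chart (1 / \<beta>) (chart \<beta> p + (chart \<beta> q - chart \<beta> e))) else None)"
proof -
  have "chart \<beta> q - chart \<beta> e \<in> lower_mats"
    using e q by (intro lower_mats_diff pos_lower_mats_subset chart_pos_lower)
  then show ?thesis
    using assms \<beta>
    by (simp add: gyro_add_def riem_log_eq par_transport_eq riem_exp_eq dchart_lower dchart_inverse)
qed

lemma gyro_scale_eq: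
  assumes e: "e \<in> pos_lower_mats" and p: "p \<in> pos_lower_mats"
  shows "gyro_scale lower_mats pos_lower_mats g e t p =
    (if chart \<beta> e + t *\<^sub>R (chart \<beta> p - chart \<beta> e) \<in> pos_lower_mats
     then Some (chart (1 / \<beta>) (chart \<beta> e + t *\<^sub>R (chart \<beta> p - chart \<beta> e))) else None)"
proof -
  have "chart \<beta> p - chart \<beta> e \<in> lower_mats"
    using e p by (intro lower_mats_diff pos_lower_mats_subset chart_pos_lower)
  then show ?thesis
    using assms \<beta>
    by (simp add: gyro_scale_def riem_log_eq riem_exp_eq dchart_lower lower_mats_scaleR
        dchart_scaleR dchart_inverse)
qed

end

section \<open>The two metrics\<close>

lemma inner_diag:
  "(\<chi> i j. if i = j then f i else 0) \<bullet> (\<chi> i j. if i = j then h i else 0)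
    = (\<Sum>i\<in>UNIV. f i * h i :: real)"
  by (simp add: inner_vec_def if_distrib cong: if_cong)

lemma diag_mult_diag_part:
  "(\<chi> i j. if i = j then f i else 0) ** diag_part X = (\<chi> i j. if i = j then f i * X $ i $ i else 0)"
  by (simp add: matrix_matrix_mult_def diag_part_def vec_eq_iff mult_delta_left)

lemma diag_powr_diag_part:
  "diag_powr (diag_part L) r = (\<chi> i j. if i = j then L $ i $ i powr r else 0)"
  by (simp add: diag_powr_def diag_part_def vec_eq_iff)

text \<open>\<open>matrix_inv\<close> is a \<open>SOME\<close> choice; uniqueness of inverses
  identifies it with the explicit diagonal matrix.\<close>

lemma matrix_inv_pos_diag:
  assumes "M \<in> pos_diag_mats"
  shows "matrix_inv M = (\<chi> i j. if i = j then 1 / M $ i $ i else 0)" (is "_ = ?N")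
proof -
  have "M $ i $ j = 0" if "i \<noteq> j" for i j
    using assms that by (simp add: pos_diag_mats_def)
  moreover have "M $ i $ i \<noteq> 0" for i
    using assms by (auto simp: pos_diag_mats_def less_le)
  ultimately have N: "M ** ?N = mat 1" "?N ** M = mat 1"
    by (auto simp: matrix_matrix_mult_def mat_def vec_eq_iff mult_delta_left mult_delta_right)
  then have "\<exists>A'. M ** A' = mat 1 \<and> A' ** M = mat 1"
    by blast
  then have inv: "M ** matrix_inv M = mat 1"
    unfolding matrix_inv_def by (rule someI_ex[THEN conjunct1])
  have "matrix_inv M = (?N ** M) ** matrix_inv M"
    unfolding N(2) by (rule matrix_mul_lid[symmetric])
  also have "\<dots> = ?N ** mat 1"
    unfolding matrix_mul_assoc[symmetric] inv ..
  also have "\<dots> = ?N"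
    by (rule matrix_mul_rid)
  finally show ?thesis .
qed

text \<open>The power occurs in both arguments of the inner product, so the exponent is
  \<open>2 * (\<theta> - 1)\<close> and \<open>\<beta> = \<theta>\<close>.\<close>

lemma diag_power_metric_dpm:
  fixes \<theta> :: real
  assumes "\<theta> \<noteq> 0"
  shows "diag_power_metric \<theta> (\<lambda>_. 1) (dpm \<theta> :: 'n::{finite,linorder} sqmat \<Rightarrow> _)"
proof
  fix L X Y :: "'n sqmat"
  have "x powr (\<theta> - 1) * x powr (\<theta> - 1) = x powr (2 * \<theta> - 2)" for x :: real
    by (simp flip: powr_add)
  then have "x powr (\<theta> - 1) * y * (x powr (\<theta> - 1) * z) = x powr (2 * \<theta> - 2) * y * z"
    for x y z :: real
    by (metis mult.assoc mult.left_commute)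
  then show "dpm \<theta> L X Y = strict_lower X \<bullet> strict_lower Y
      + (\<Sum>i\<in>UNIV. 1 * L $ i $ i powr (2 * \<theta> - 2) * X $ i $ i * Y $ i $ i)"
    by (simp only: dpm_def diag_powr_diag_part diag_mult_diag_part inner_diag mult_1_left)
qed (use assms in simp_all)

text \<open>The power occurs in one argument only: \<open>\<theta> - 2 = 2 * \<beta> - 2\<close>
  gives \<open>\<beta> = \<theta> / 2\<close>. The weights absorb \<open>1 / 4\<close> and the
  inverse of \<open>M\<close>.\<close>

lemma diag_power_metric_dbwm:
  fixes M :: "'n::{finite,linorder} sqmat"
  assumes "\<theta> \<noteq> 0" "M \<in> pos_diag_mats"
  shows "diag_power_metric (\<theta> / 2) (\<lambda>i. 1 / (4 * M $ i $ i)) (dbwm \<theta> M)"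
proof
  fix L X Y :: "'n sqmat"
  show "dbwm \<theta> M L X Y = strict_lower X \<bullet> strict_lower Y
      + (\<Sum>i\<in>UNIV. 1 / (4 * M $ i $ i) * L $ i $ i powr (2 * (\<theta> / 2) - 2) * X $ i $ i * Y $ i $ i)"
    unfolding dbwm_def matrix_inv_pos_diag[OF assms(2)] diag_powr_diag_part diag_mult_diag_part
      inner_diag sum_distrib_left
    by (simp add: mult_ac)
qed (use assms in \<open>simp_all add: pos_diag_mats_def\<close>)

section \<open>Back to strictly lower and diagonal parts\<close>

lemma pos_lower_mats_iff_diag:
  assumes "A \<in> lower_mats" "diag_part A = D"
  shows "A \<in> pos_lower_mats \<longleftrightarrow> D \<in> pos_diag_mats"
  using assms by (auto simp: pos_lower_mats_def pos_diag_mats_def diag_part_def)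

text \<open>\<open>chart\<close> keeps the entries above the diagonal, and these vanish for lower
  triangular \<open>A\<close>.\<close>

lemma chart_lower_eq:
  assumes "A \<in> lower_mats"
  shows "chart r A = strict_lower A + diag_powr (diag_part A) r"
proof -
  have "chart r A $ i $ j = (strict_lower A + diag_powr (diag_part A) r) $ i $ j" for i j
    using assms by (cases i j rule: linorder_cases)
      (auto simp: chart_def strict_lower_def diag_powr_diag_part lower_mats_def)
  then show ?thesis
    by (simp add: vec_eq_iff)
qed

theorem lemma3p6:
  fixes \<theta> \<beta> t :: real
    and M L K :: "'n::{finite,linorder} sqmat"
    and g :: "'n sqmat \<Rightarrow> 'n sqmat \<Rightarrow> 'n sqmat \<Rightarrow> real"
  assumes "\<theta> \<noteq> 0"
    and "M \<in> pos_diag_mats"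
    and "(g = dpm \<theta> \<and> \<beta> = \<theta>) \<or> (g = dbwm \<theta> M \<and> \<beta> = \<theta> / 2)"
    and "L \<in> pos_lower_mats" and "K \<in> pos_lower_mats"
  shows "gyro_add lower_mats pos_lower_mats g (mat 1) L K =
      (if diag_powr (diag_part L) \<beta> + diag_powr (diag_part K) \<beta> - mat 1 \<in> pos_diag_mats
       then Some (strict_lower L + strict_lower K
         + diag_powr (diag_powr (diag_part L) \<beta> + diag_powr (diag_part K) \<beta> - mat 1) (1 / \<beta>))
       else None)
    \<and> gyro_scale lower_mats pos_lower_mats g (mat 1) t L =
      (if (1 - t) *\<^sub>R mat 1 + t *\<^sub>R diag_powr (diag_part L) \<beta> \<in> pos_diag_mats
       then Some (t *\<^sub>R strict_lower L
         + diag_powr (t *\<^sub>R diag_powr (diag_part L) \<beta> + (1 - t) *\<^sub>R mat 1) (1 / \<beta>))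
       else None)"
proof -
  \<comment> \<open>Each metric has its own weights; the existential lets one argument serve
    both.\<close>
  have "\<exists>a. diag_power_metric \<beta> a g"
    using assms(3) diag_power_metric_dpm[OF assms(1)] diag_power_metric_dbwm[OF assms(1,2)] by auto
  then obtain a where "diag_power_metric \<beta> a g" ..
  then interpret diag_power_metric \<beta> a g .
  \<comment> \<open>The chart values of the gyro sum and the gyro multiple, as
    \<open>chart \<beta>\<close> fixes the origin \<open>mat 1\<close>.\<close>
  let ?A = "chart \<beta> L + (chart \<beta> K - mat 1)" and ?S = "mat 1 + t *\<^sub>R (chart \<beta> L - mat 1)"
  have lower: "?A \<in> lower_mats" "?S \<in> lower_mats"
    using assms(4,5)
    by (simp_all add: lower_mats_add lower_mats_diff lower_mats_scaleR pos_lower_mats_subset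
        chart_pos_lower mat_1_pos_lower)
  have A: "diag_part ?A = diag_powr (diag_part L) \<beta> + diag_powr (diag_part K) \<beta> - mat 1"
    "strict_lower ?A = strict_lower L + strict_lower K"
    by (auto simp: diag_part_def strict_lower_def chart_def diag_powr_def mat_def vec_eq_iff)
  have S: "diag_part ?S = t *\<^sub>R diag_powr (diag_part L) \<beta> + (1 - t) *\<^sub>R mat 1"
    "strict_lower ?S = t *\<^sub>R strict_lower L"
    by (auto simp: diag_part_def strict_lower_def chart_def diag_powr_def mat_def vec_eq_iff
        algebra_simps)
  have "chart (1 / \<beta>) ?A = strict_lower L + strict_lower K
      + diag_powr (diag_powr (diag_part L) \<beta> + diag_powr (diag_part K) \<beta> - mat 1) (1 / \<beta>)"
    "chart (1 / \<beta>) ?S = t *\<^sub>R strict_lower L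
      + diag_powr (t *\<^sub>R diag_powr (diag_part L) \<beta> + (1 - t) *\<^sub>R mat 1) (1 / \<beta>)"
    unfolding chart_lower_eq[OF lower(1)] chart_lower_eq[OF lower(2)] A S by (rule refl)+
  moreover have "?S \<in> pos_lower_mats \<longleftrightarrow>
      (1 - t) *\<^sub>R mat 1 + t *\<^sub>R diag_powr (diag_part L) \<beta> \<in> pos_diag_mats"
    unfolding pos_lower_mats_iff_diag[OF lower(2) S(1)] by (simp only: add.commute)
  ultimately show ?thesis
    unfolding gyro_add_eq[OF mat_1_pos_lower assms(4,5)] gyro_scale_eq[OF mat_1_pos_lower assms(4)]
      chart_mat_1 pos_lower_mats_iff_diag[OF lower(1) A(1)]
    by (simp only: simp_thms)
qed

end
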